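(* Let $\{\eta^i_q\in V_{\mathbb{H}}^R \mid i=1,\dots,n,\ q\in\mathbb{H}\}$ be a rank $n$ right quaternionic continuous frame with frame operator $A$ and bounds $m(A)$ and $M(A)$. Then any family $\{\zeta^i_q\in V_{\mathbb{H}}^R \mid i=1,\dots,n,\ q\in\mathbb{H}\}$ satisfying $$\kappa:=\sum_{i=1}^{n}\int_{\mathbb{H}}\left\|\eta^i_q-\zeta^i_q\right\|^2\,d\mu(q)<m(A)$$ is a rank $n$ continuous frame for $V_{\mathbb{H}}^R$ with bounds $m(A)\left(1-\sqrt{\frac{\kappa}{m(A)}}\right)^{2}$ and $M(A)\left(1+\sqrt{\frac{\kappa}{M(A)}}\right)^{2}$.
   Context: $\mathbb{H}$ denotes the quaternions, equipped with a fixed measure $\mu$; $n\ge 1$ is an integer. $V_{\mathbb{H}}^R$ is a separable right quaternionic Hilbert space, whose inner product $\langle\cdot|\cdot\rangle$ is $\mathbb{H}$-valued with $\overline{\langle\phi|\psi\rangle}=\langle\psi|\phi\rangle$, $\langle\phi|\psi p\rangle=\langle\phi|\psi\rangle p$, $\langle\phi p|\psi\rangle=\overline{p}\langle\phi|\psi\rangle$. Operators are right linear. Families are assumed measurable in $q$ so that the integrals make sense; operator integrals are understood weakly, with $|\eta\rangle\langle\zeta|\,\phi=\eta\langle\zeta|\phi\rangle$. Rank $n$ right quaternionic continuous frame: a family $\{\eta^i_q\}$ such that for each $q$ the vectors $\eta^1_q,\dots,\eta^n_q$ are linearly independent, and there is a positive operator $A$ on $V_{\mathbb{H}}^R$, bounded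 with bounded inverse, with $\sum_{i=1}^n\int_{\mathbb{H}}|\eta^i_q\rangle\langle\eta^i_q|\,d\mu(q)=A$. $A$ is its frame operator, and its bounds are $m(A)=\inf_{\|\phi\|=1}\langle\phi|A\phi\rangle$ and $M(A)=\sup_{\|\phi\|=1}\langle\phi|A\phi\rangle$. Rank $n$ continuous frame with bounds $C,D$ (for a general family $\{\xi^i_q\}$, no linear independence required): constants $C,D>0$ with $C\|\phi\|^2\le\sum_{i=1}^n\int_{\mathbb{H}}|\langle\xi^i_q|\phi\rangle|^2\,d\mu(q)\le D\|\phi\|^2$ for all $\phi\in V_{\mathbb{H}}^R$. *)

theory Defs
  imports "HOL-Analysis.Analysis"
begin

datatype quat = Quat (qRe: real) (qIm1: real) (qIm2: real) (qIm3: real)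

lemma quat_eq_iff:
  "x = y \<longleftrightarrow> qRe x = qRe y \<and> qIm1 x = qIm1 y \<and> qIm2 x = qIm2 y \<and> qIm3 x = qIm3 y"
  by (cases x; cases y) simp

instantiation quat :: ring_1
begin

definition "0 = Quat 0 0 0 0"
definition "1 = Quat 1 0 0 0"
definition "x + y = Quat (qRe x + qRe y) (qIm1 x + qIm1 y) (qIm2 x + qIm2 y) (qIm3 x + qIm3 y)"
definition "- x = Quat (- qRe x) (- qIm1 x) (- qIm2 x) (- qIm3 x)"
definition "x - y = Quat (qRe x - qRe y) (qIm1 x - qIm1 y) (qIm2 x - qIm2 y) (qIm3 x - qIm3 y)"
definition "x * y = Quat
  (qRe x * qRe y - qIm1 x * qIm1 y - qIm2 x * qIm2 y - qIm3 x * qIm3 y)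
  (qRe x * qIm1 y + qIm1 x * qRe y + qIm2 x * qIm3 y - qIm3 x * qIm2 y)
  (qRe x * qIm2 y - qIm1 x * qIm3 y + qIm2 x * qRe y + qIm3 x * qIm1 y)
  (qRe x * qIm3 y + qIm1 x * qIm2 y - qIm2 x * qIm1 y + qIm3 x * qRe y)"

instance
  by standard
    (simp_all add: quat_eq_iff zero_quat_def one_quat_def plus_quat_def uminus_quat_def
      minus_quat_def times_quat_def algebra_simps)

end

lemma quat_sel [simp]:
  "qRe 0 = 0" "qIm1 0 = 0" "qIm2 0 = 0" "qIm3 0 = 0"
  "qRe 1 = 1" "qIm1 1 = 0" "qIm2 1 = 0" "qIm3 1 = 0"
  "qRe (x + y) = qRe x + qRe y" "qIm1 (x + y) = qIm1 x + qIm1 y"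
  "qIm2 (x + y) = qIm2 x + qIm2 y" "qIm3 (x + y) = qIm3 x + qIm3 y"
  "qRe (- x) = - qRe x" "qIm1 (- x) = - qIm1 x"
  "qIm2 (- x) = - qIm2 x" "qIm3 (- x) = - qIm3 x"
  "qRe (x - y) = qRe x - qRe y" "qIm1 (x - y) = qIm1 x - qIm1 y"
  "qIm2 (x - y) = qIm2 x - qIm2 y" "qIm3 (x - y) = qIm3 x - qIm3 y"
  "qRe (x * y) = qRe x * qRe y - qIm1 x * qIm1 y - qIm2 x * qIm2 y - qIm3 x * qIm3 y"
  "qIm1 (x * y) = qRe x * qIm1 y + qIm1 x * qRe y + qIm2 x * qIm3 y - qIm3 x * qIm2 y"
  "qIm2 (x * y) = qRe x * qIm2 y - qIm1 x * qIm3 y + qIm2 x * qRe y + qIm3 x * qIm1 y"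
  "qIm3 (x * y) = qRe x * qIm3 y + qIm1 x * qIm2 y - qIm2 x * qIm1 y + qIm3 x * qRe y"
  by (simp_all add: zero_quat_def one_quat_def plus_quat_def uminus_quat_def
      minus_quat_def times_quat_def)

instantiation quat :: real_algebra_1
begin

definition "r *\<^sub>R x = Quat (r * qRe x) (r * qIm1 x) (r * qIm2 x) (r * qIm3 x)"

instance
  by standard (simp_all add: quat_eq_iff scaleR_quat_def algebra_simps)

end

lemma quat_sel_scaleR [simp]:
  "qRe (r *\<^sub>R x) = r * qRe x" "qIm1 (r *\<^sub>R x) = r * qIm1 x"
  "qIm2 (r *\<^sub>R x) = r * qIm2 x" "qIm3 (r *\<^sub>R x) = r * qIm3 x"
  by (simp_all add: scaleR_quat_def)

instantiation quat :: real_inner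
begin

definition inner_quat :: "quat \<Rightarrow> quat \<Rightarrow> real" where
  "inner_quat x y = qRe x * qRe y + qIm1 x * qIm1 y + qIm2 x * qIm2 y + qIm3 x * qIm3 y"
definition norm_quat :: "quat \<Rightarrow> real" where
  "norm_quat x = sqrt (inner x x)"
definition sgn_quat :: "quat \<Rightarrow> quat" where
  "sgn_quat x = x /\<^sub>R norm x"
definition dist_quat :: "quat \<Rightarrow> quat \<Rightarrow> real" where
  "dist_quat x y = norm (x - y)"
definition [code del]:
  "(uniformity :: (quat \<times> quat) filter) = (INF e\<in>{0 <..}. principal {(x, y). dist x y < e})"
definition [code del]:
  "open (U :: quat set) \<longleftrightarrow> (\<forall>x\<in>U. eventually (\<lambda>(x', y). x' = x \<longrightarrow> y \<in> U) uniformity)"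

instance
proof
  fix x y z :: quat and r :: real and U :: "quat set"
  show "inner x x = 0 \<longleftrightarrow> x = 0"
    by (simp add: inner_quat_def quat_eq_iff add_nonneg_eq_0_iff)
  show "inner x y = inner y x" "inner (x + y) z = inner x z + inner y z"
    "inner (r *\<^sub>R x) y = r * inner x y" "0 \<le> inner x x"
    by (simp_all add: inner_quat_def algebra_simps)
qed (rule norm_quat_def sgn_quat_def dist_quat_def uniformity_quat_def open_quat_def)+

end

instantiation quat :: real_normed_div_algebra
begin

definition "inverse x = Quat (qRe x) (- qIm1 x) (- qIm2 x) (- qIm3 x) /\<^sub>R inner x x"
definition "x div (y :: quat) = x * inverse y"

instance
proof
  fix x y :: quat
  have conj: "Quat (qRe x) (- qIm1 x) (- qIm2 x) (- qIm3 x) * x = inner x x *\<^sub>R 1"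
    "x * Quat (qRe x) (- qIm1 x) (- qIm2 x) (- qIm3 x) = inner x x *\<^sub>R 1"
    by (simp_all add: quat_eq_iff inner_quat_def)
  show "x \<noteq> 0 \<Longrightarrow> inverse x * x = 1" "x \<noteq> 0 \<Longrightarrow> x * inverse x = 1"
    by (simp_all add: inverse_quat_def conj)
  show "x div y = x * inverse y"
    by (rule divide_quat_def)
  show "inverse (0 :: quat) = 0"
    by (simp add: inverse_quat_def)
  have "inner (x * y) (x * y) = inner x x * inner y y"
    by (simp add: inner_quat_def) algebra
  then show "norm (x * y) = norm x * norm y"
    by (simp add: norm_quat_def real_sqrt_mult)
qed

end

instantiation quat :: euclidean_space
begin

definition "Basis = {Quat 1 0 0 0, Quat 0 1 0 0, Quat 0 0 1 0, Quat 0 0 0 1}"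

instance
proof
  show "Basis \<noteq> ({} :: quat set)" "finite (Basis :: quat set)"
    by (simp_all add: Basis_quat_def)
  show "inner u v = (if u = v then 1 else 0)" if "u \<in> Basis" "v \<in> Basis" for u v :: quat
    using that unfolding Basis_quat_def by (elim insertE emptyE) (simp_all add: inner_quat_def)
  show "(\<forall>u\<in>Basis. inner x u = 0) \<longleftrightarrow> x = 0" for x :: quat
    unfolding quat_eq_iff by (simp add: Basis_quat_def inner_quat_def)
qed

end

definition qcnj :: "quat \<Rightarrow> quat" where
  "qcnj x = Quat (qRe x) (- qIm1 x) (- qIm2 x) (- qIm3 x)"


text \<open>
  The inner product is conjugate linear in the first argument and right linear in the second.
  The real structure is the restriction of the right action to the real quaternions.
  The norm laws inherited from the superclass follow from the inner product axioms; the
  superclass only supplies the metric and the topology.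
\<close>

class right_quaternionic_inner = real_normed_vector +
  fixes scaleQ :: "'a \<Rightarrow> quat \<Rightarrow> 'a"  (infixl \<open>*\<^sub>Q\<close> 75)
    and qinner :: "'a \<Rightarrow> 'a \<Rightarrow> quat"
  assumes scaleQ_add_left: "(x + y) *\<^sub>Q p = x *\<^sub>Q p + y *\<^sub>Q p"
    and scaleQ_add_right: "x *\<^sub>Q (p + r) = x *\<^sub>Q p + x *\<^sub>Q r"
    and scaleQ_scaleQ: "(x *\<^sub>Q p) *\<^sub>Q r = x *\<^sub>Q (p * r)"
    and scaleQ_of_real: "x *\<^sub>Q of_real a = a *\<^sub>R x"
    and qcnj_qinner: "qcnj (qinner x y) = qinner y x"
    and qinner_add_right: "qinner x (y + z) = qinner x y + qinner x z"
    and qinner_scaleQ_right: "qinner x (y *\<^sub>Q p) = qinner x y * p"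
    and qinner_scaleQ_left: "qinner (x *\<^sub>Q p) y = qcnj p * qinner x y"
    and qinner_ge_zero: "0 \<le> qRe (qinner x x)"
    and qinner_eq_zero_iff: "qinner x x = 0 \<longleftrightarrow> x = 0"
    and norm_eq_sqrt_qinner: "norm x = sqrt (qRe (qinner x x))"

text \<open>
  Density is written with the distance because the closure operator is not available in a
  class specification.
\<close>

class right_quaternionic_hilbert = right_quaternionic_inner + complete_space +
  assumes separable: "\<exists>D :: 'a set. countable D \<and> (\<forall>x. \<forall>e>0. \<exists>y\<in>D. dist y x < e)"

instance right_quaternionic_hilbert \<subseteq> second_countable_topology
proof
  obtain D :: "'a set"
    where D: "countable D" "\<And>x e. 0 < e \<Longrightarrow> \<exists>y\<in>D. dist y x < e"
    using separable by blast
  let ?B = "case_prod ball ` (D \<times> (\<rat> \<inter> {0<..}))"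
  have "topological_basis ?B"
  proof (rule topological_basisI)
    show "open U" if "U \<in> ?B" for U
      using that by auto
  next
    fix U and x :: 'a
    assume "open U" "x \<in> U"
    then obtain e where e: "e > 0" "ball x e \<subseteq> U"
      by (meson openE)
    obtain y where y: "y \<in> D" "dist y x < e / 3"
      using D(2) [of "e / 3" x] e(1) by auto
    obtain r where r: "r \<in> \<rat>" "e / 3 < r" "r < e / 2"
      using Rats_dense_in_real [of "e / 3" "e / 2"] e(1) by auto
    have "ball y r \<subseteq> ball x e"
    proof
      fix z
      assume "z \<in> ball y r"
      then have "dist y z < r" by simp
      then show "z \<in> ball x e"
        using y(2) r(3) e(1) dist_triangle [of x z y] by (simp add: dist_commute)
    qed
    moreover have "x \<in> ball y r"
      using y r by simp
    moreover have "ball y r \<in> ?B"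
      using y(1) r e(1) by (intro image_eqI [of _ _ "(y, r)"]) auto
    ultimately show "\<exists>B'\<in>?B. x \<in> B' \<and> B' \<subseteq> U"
      using e(2) by (intro bexI [of _ "ball y r"] conjI) auto
  qed
  moreover have "countable ?B"
    using D(1) countable_rat by (intro countable_image countable_SIGMA countable_Int1) auto
  ultimately show "\<exists>B :: 'a set set. countable B \<and> open = generate_topology B"
    using topological_basis_imp_subbasis by blast
qed

definition right_linear ::
  "('a :: right_quaternionic_inner \<Rightarrow> 'b :: right_quaternionic_inner) \<Rightarrow> bool" where
  "right_linear T \<longleftrightarrow>
    (\<forall>x y. T (x + y) = T x + T y) \<and> (\<forall>x p. T (x *\<^sub>Q p) = T x *\<^sub>Q p)"

definition bounded_right_linear ::
  "('a :: right_quaternionic_inner \<Rightarrow> 'b :: right_quaternionic_inner) \<Rightarrow> bool" where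
  "bounded_right_linear T \<longleftrightarrow> right_linear T \<and> (\<exists>K. \<forall>x. norm (T x) \<le> K * norm x)"

definition has_bounded_inverse :: "('a :: right_quaternionic_inner \<Rightarrow> 'a) \<Rightarrow> bool" where
  "has_bounded_inverse T \<longleftrightarrow> (\<exists>S. bounded_right_linear S \<and> S \<circ> T = id \<and> T \<circ> S = id)"

definition positive_operator :: "('a :: right_quaternionic_inner \<Rightarrow> 'a) \<Rightarrow> bool" where
  "positive_operator T \<longleftrightarrow>
    right_linear T \<and> (\<forall>x. qinner x (T x) \<in> \<real> \<and> 0 \<le> qRe (qinner x (T x)))"

text \<open>
  The quadratic form is quaternion valued; for a positive operator it is real, so the real
  part below discards nothing. The infimum and supremum are meaningful because the unit sphere
  is nonempty (the space contains independent vectors) and the operator is bounded.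
\<close>

definition op_lower :: "('a :: right_quaternionic_inner \<Rightarrow> 'a) \<Rightarrow> real" where
  "op_lower T = (INF x\<in>{x. norm x = 1}. qRe (qinner x (T x)))"

definition op_upper :: "('a :: right_quaternionic_inner \<Rightarrow> 'a) \<Rightarrow> real" where
  "op_upper T = (SUP x\<in>{x. norm x = 1}. qRe (qinner x (T x)))"

definition right_independent ::
  "'i set \<Rightarrow> ('i \<Rightarrow> 'a :: right_quaternionic_inner) \<Rightarrow> bool" where
  "right_independent I v \<longleftrightarrow>
    (\<forall>c :: 'i \<Rightarrow> quat. (\<Sum>i\<in>I. v i *\<^sub>Q c i) = 0 \<longrightarrow> (\<forall>i\<in>I. c i = 0))"


definition ket_bra :: "'a :: right_quaternionic_inner \<Rightarrow> 'a \<Rightarrow> 'a \<Rightarrow> 'a" where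
  "ket_bra u v x = u *\<^sub>Q qinner v x"

definition measurable_family ::
  "quat measure \<Rightarrow> nat \<Rightarrow> (nat \<Rightarrow> quat \<Rightarrow> 'a :: right_quaternionic_inner) \<Rightarrow> bool" where
  "measurable_family \<mu> n \<eta> \<longleftrightarrow> (\<forall>i\<in>{1..n}. \<eta> i \<in> borel_measurable \<mu>)"

text \<open>The operator integral is weak: all matrix elements of both sides agree.\<close>

definition is_frame_operator ::
  "quat measure \<Rightarrow> nat \<Rightarrow> (nat \<Rightarrow> quat \<Rightarrow> 'a :: right_quaternionic_inner) \<Rightarrow> ('a \<Rightarrow> 'a) \<Rightarrow> bool"
  where
  "is_frame_operator \<mu> n \<eta> A \<longleftrightarrow>
    (\<forall>x y. (\<forall>i\<in>{1..n}. integrable \<mu> (\<lambda>q. qinner x (ket_bra (\<eta> i q) (\<eta> i q) y))) \<and>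
      (\<Sum>i=1..n. LINT q|\<mu>. qinner x (ket_bra (\<eta> i q) (\<eta> i q) y)) = qinner x (A y))"

definition rank_continuous_frame_op ::
  "quat measure \<Rightarrow> nat \<Rightarrow> (nat \<Rightarrow> quat \<Rightarrow> 'a :: right_quaternionic_inner) \<Rightarrow> ('a \<Rightarrow> 'a) \<Rightarrow> bool"
  where
  "rank_continuous_frame_op \<mu> n \<eta> A \<longleftrightarrow>
    measurable_family \<mu> n \<eta> \<and>
    (\<forall>q. right_independent {1..n} (\<lambda>i. \<eta> i q)) \<and>
    positive_operator A \<and> bounded_right_linear A \<and> has_bounded_inverse A \<and>
    is_frame_operator \<mu> n \<eta> A"

text \<open>
  The integrals are taken in the extended nonnegative reals, so the upper bound includes
  their finiteness.
\<close>

definition rank_continuous_frame_bounds ::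
  "quat measure \<Rightarrow> nat \<Rightarrow> (nat \<Rightarrow> quat \<Rightarrow> 'a :: right_quaternionic_inner) \<Rightarrow> real \<Rightarrow> real \<Rightarrow> bool"
  where
  "rank_continuous_frame_bounds \<mu> n \<xi> C D \<longleftrightarrow>
    measurable_family \<mu> n \<xi> \<and> 0 < C \<and> 0 < D \<and>
    (\<forall>x. ennreal (C * (norm x)\<^sup>2)
            \<le> (\<Sum>i=1..n. \<integral>\<^sup>+ q. ennreal ((norm (qinner (\<xi> i q) x))\<^sup>2) \<partial>\<mu>) \<and>
         (\<Sum>i=1..n. \<integral>\<^sup>+ q. ennreal ((norm (qinner (\<xi> i q) x))\<^sup>2) \<partial>\<mu>)
            \<le> ennreal (D * (norm x)\<^sup>2))"

end

theory Submission
  imports Defs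
begin

text \<open>
  Write $F_\xi(x) = \sum_i \int |\langle \xi^i_q | x\rangle|^2 d\mu(q)$. The square root of
  $F_\xi(x)$ is an $L^2$ norm, so Minkowski's inequality applied to $\zeta = \eta - (\eta - \zeta)$
  and $\eta = \zeta + (\eta - \zeta)$ bounds its variation by the square root of
  $F_{\eta - \zeta}(x)$, which by Cauchy-Schwarz is at most $\sqrt{\kappa}\,\|x\|$. On the other
  hand $F_\eta(x) = \langle x | A x\rangle$ lies between $m(A) \|x\|^2$ and $M(A) \|x\|^2$.
\<close>

section \<open>Quaternionic inner products\<close>

lemma qcnj_sel [simp]:
  "qRe (qcnj x) = qRe x" "qIm1 (qcnj x) = - qIm1 x"
  "qIm2 (qcnj x) = - qIm2 x" "qIm3 (qcnj x) = - qIm3 x"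
  by (simp_all add: qcnj_def)

lemma qcnj_add: "qcnj (x + y) = qcnj x + qcnj y"
  by (simp add: quat_eq_iff)

lemma qcnj_scaleR: "qcnj (a *\<^sub>R x) = a *\<^sub>R qcnj x"
  by (simp add: quat_eq_iff)

lemma norm_quat_square: "(norm x)\<^sup>2 = (qRe x)\<^sup>2 + (qIm1 x)\<^sup>2 + (qIm2 x)\<^sup>2 + (qIm3 x)\<^sup>2"
  by (simp add: norm_quat_def inner_quat_def power2_eq_square)

lemma norm_qcnj [simp]: "norm (qcnj x) = norm x"
  by (simp add: norm_quat_def inner_quat_def)

lemma qcnj_mult_self: "qcnj x * x = of_real ((norm x)\<^sup>2)"
  unfolding norm_quat_square of_real_def quat_eq_iff by (simp add: power2_eq_square)

text \<open>This allows the real part to be exchanged with quaternion-valued integrals, which links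
  the weak operator integral to real integrals.\<close>

lemma bounded_linear_qRe: "bounded_linear qRe"
proof (rule bounded_linear_intro)
  show "norm (qRe x) \<le> norm x * 1" for x
    by (simp add: abs_le_square_iff [of "qRe x" "norm x", simplified] norm_quat_square)
qed simp_all

lemma qinner_add_left: "qinner (x + y) z = qinner x z + qinner y z"
  by (metis qcnj_add qcnj_qinner qinner_add_right)

lemma qinner_scaleR_right: "qinner x (a *\<^sub>R y) = a *\<^sub>R qinner x y"
  by (simp add: scaleQ_of_real [symmetric] qinner_scaleQ_right) (simp add: of_real_def)

lemma qinner_scaleR_left: "qinner (a *\<^sub>R x) y = a *\<^sub>R qinner x y"
  by (metis qcnj_qinner qcnj_scaleR qinner_scaleR_right)

lemma qinner_diff_left: "qinner (x - y) z = qinner x z - qinner y z"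
  by (metis add_diff_cancel_right' diff_add_cancel qinner_add_left)

lemma norm_square_eq_qinner: "(norm x)\<^sup>2 = qRe (qinner x x)"
  by (simp add: norm_eq_sqrt_qinner qinner_ge_zero)

text \<open>Conjugate symmetry fixes \<open>qinner x x\<close> under \<open>qcnj\<close>, so its
  three imaginary parts vanish.\<close>

lemma qinner_self: "qinner x x = of_real ((norm x)\<^sup>2)"
proof -
  have "qcnj (qinner x x) = qinner x x"
    by (rule qcnj_qinner)
  then show ?thesis
    by (auto simp: quat_eq_iff norm_square_eq_qinner of_real_def)
qed

text \<open>In \<open>qinner (x *\<^sub>Q p) (x *\<^sub>Q p)\<close> the factor between
  \<open>qcnj p\<close> and \<open>p\<close> is real, hence central, and can be pulled out despite
  noncommutativity.\<close>

lemma norm_scaleQ: "norm (x *\<^sub>Q p) = norm x * norm p"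
proof -
  have "qinner (x *\<^sub>Q p) (x *\<^sub>Q p) = qcnj p * (of_real ((norm x)\<^sup>2) * p)"
    by (simp only: qinner_scaleQ_left qinner_scaleQ_right qinner_self [of x] mult.assoc)
  also have "\<dots> = (norm x)\<^sup>2 *\<^sub>R (qcnj p * p)"
    by (simp only: of_real_def mult_scaleR_left mult_scaleR_right mult_1)
  also have "\<dots> = of_real ((norm x * norm p)\<^sup>2)"
    by (simp add: qcnj_mult_self of_real_def power_mult_distrib)
  finally have "(norm (x *\<^sub>Q p))\<^sup>2 = (norm x * norm p)\<^sup>2"
    by (simp add: norm_square_eq_qinner of_real_def)
  then show ?thesis
    by (simp add: power2_eq_iff_nonneg)
qed

text \<open>The triangle inequality is already a norm law here, so squaring it and expanding leaves
  exactly the Cauchy-Schwarz inequality for the real part.\<close>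

lemma qRe_qinner_le: "qRe (qinner x y) \<le> norm x * norm y"
proof -
  have "(norm (x + y))\<^sup>2 \<le> (norm x + norm y)\<^sup>2"
    by (intro power_mono norm_triangle_ineq norm_ge_zero)
  moreover have "qRe (qinner y x) = qRe (qinner x y)"
    by (metis qcnj_qinner qcnj_sel(1))
  ultimately show ?thesis
    by (simp add: power2_sum norm_square_eq_qinner qinner_add_left qinner_add_right)
qed

text \<open>Full Cauchy-Schwarz follows from the real part by multiplying \<open>y\<close> on the
  right with the conjugate of \<open>qinner x y\<close>: the new inner product is real and equals
  the squared modulus.\<close>

lemma norm_qinner_le: "norm (qinner x y) \<le> norm x * norm y"
proof -
  let ?c = "qinner x y"
  have "(norm ?c)\<^sup>2 = qRe (?c * qcnj ?c)"
    by (simp add: norm_quat_square) (simp add: power2_eq_square)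
  also have "\<dots> = qRe (qinner x (y *\<^sub>Q qcnj ?c))"
    by (simp only: qinner_scaleQ_right)
  also have "\<dots> \<le> norm x * (norm y * norm ?c)"
    using qRe_qinner_le [of x "y *\<^sub>Q qcnj ?c"] by (simp add: norm_scaleQ)
  finally have "norm ?c * norm ?c \<le> (norm x * norm y) * norm ?c"
    by (simp add: power2_eq_square mult.assoc)
  then show ?thesis
    by (cases "norm ?c = 0") (auto dest: mult_right_le_imp_le)
qed

lemma bounded_linear_qinner_left: "bounded_linear (\<lambda>x. qinner x y)"
  by (rule bounded_linear_intro [where K = "norm y"])
    (simp_all add: qinner_add_left qinner_scaleR_left norm_qinner_le)

lemma qinner_zero_left [simp]: "qinner 0 y = 0"
  by (rule linear_0 [OF bounded_linear.linear [OF bounded_linear_qinner_left]])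

lemma borel_measurable_qinner_left:
  assumes "f \<in> borel_measurable M"
  shows "(\<lambda>q. qinner (f q) x) \<in> borel_measurable M"
proof (rule measurable_compose [OF assms])
  show "(\<lambda>u. qinner u x) \<in> borel_measurable borel"
    by (intro borel_measurable_continuous_onI linear_continuous_on bounded_linear_qinner_left)
qed

section \<open>Quadratic forms of operators\<close>

lemma qRe_qinner_le_square:
  fixes T :: "'a :: right_quaternionic_inner \<Rightarrow> 'a"
  assumes "bounded_right_linear T"
  obtains K where "\<And>x. qRe (qinner x (T x)) \<le> K * (norm x)\<^sup>2"
proof -
  obtain K where K: "\<And>x. norm (T x) \<le> K * norm x"
    using assms by (auto simp: bounded_right_linear_def)
  have "qRe (qinner x (T x)) \<le> K * (norm x)\<^sup>2" for x
  proof -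
    have "qRe (qinner x (T x)) \<le> norm x * norm (T x)"
      by (rule qRe_qinner_le)
    also have "\<dots> \<le> norm x * (K * norm x)"
      by (intro mult_left_mono K norm_ge_zero)
    finally show ?thesis
      by (simp add: power2_eq_square mult_ac)
  qed
  then show thesis
    by (rule that)
qed

lemma right_linear_scaleR:
  assumes "right_linear T"
  shows "T (a *\<^sub>R x) = a *\<^sub>R T x"
  using assms unfolding right_linear_def by (metis scaleQ_of_real)

text \<open>The form is homogeneous of degree two under real scaling, so estimates on the unit
  sphere, where \<open>op_lower\<close> and \<open>op_upper\<close> live, carry over to all
  vectors.\<close>

lemma qRe_qinner_normalize:
  fixes T :: "'a :: right_quaternionic_inner \<Rightarrow> 'a"
  assumes "right_linear T"
  shows "qRe (qinner x (T x)) = qRe (qinner (sgn x) (T (sgn x))) * (norm x)\<^sup>2"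
proof (cases "x = 0")
  case True
  then show ?thesis
    by simp
next
  case False
  then show ?thesis
    by (simp add: sgn_div_norm right_linear_scaleR [OF assms] qinner_scaleR_left
        qinner_scaleR_right power2_eq_square field_simps)
qed

text \<open>Positivity makes 0 a lower bound of the form on the unit sphere, so the infimum there is
  a genuine one.\<close>

lemma op_lower_le:
  fixes T :: "'a :: right_quaternionic_inner \<Rightarrow> 'a"
  assumes "positive_operator T"
  shows "op_lower T * (norm x)\<^sup>2 \<le> qRe (qinner x (T x))"
proof (cases "x = 0")
  case True
  then show ?thesis
    using assms by (simp add: positive_operator_def)
next
  case False
  have "bdd_below ((\<lambda>x. qRe (qinner x (T x))) ` {x. norm x = 1})"
    using assms by (intro bdd_belowI [of _ 0]) (auto simp: positive_operator_def)
  then have "op_lower T \<le> qRe (qinner (sgn x) (T (sgn x)))"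
    unfolding op_lower_def using False by (intro cINF_lower) (simp_all add: norm_sgn)
  then show ?thesis
    using assms
    by (subst qRe_qinner_normalize) (auto simp: positive_operator_def intro: mult_right_mono)
qed

text \<open>Here boundedness of the operator keeps the supremum over the unit sphere finite.\<close>

lemma op_upper_ge:
  fixes T :: "'a :: right_quaternionic_inner \<Rightarrow> 'a"
  assumes "bounded_right_linear T"
  shows "qRe (qinner x (T x)) \<le> op_upper T * (norm x)\<^sup>2"
proof (cases "x = 0")
  case True
  then show ?thesis
    by simp
next
  case False
  obtain K where K: "\<And>x. qRe (qinner x (T x)) \<le> K * (norm x)\<^sup>2"
    using qRe_qinner_le_square [OF assms] by blast
  have "bdd_above ((\<lambda>x. qRe (qinner x (T x))) ` {x. norm x = 1})"
  proof (rule bdd_aboveI2)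
    show "qRe (qinner x (T x)) \<le> K" if "x \<in> {x. norm x = 1}" for x
      using K [of x] that by simp
  qed
  then have "qRe (qinner (sgn x) (T (sgn x))) \<le> op_upper T"
    unfolding op_upper_def using False by (intro cSUP_upper) (simp_all add: norm_sgn)
  then show ?thesis
    using assms
    by (subst qRe_qinner_normalize) (auto simp: bounded_right_linear_def intro: mult_right_mono)
qed

section \<open>Minkowski's inequality\<close>

text \<open>Unlike the triangle inequality, this bound is linear in the squared norms and can be
  integrated term by term.\<close>

lemma norm_add_square_le:
  fixes x y :: "'a :: real_normed_vector"
  assumes "t > 0"
  shows "(norm (x + y))\<^sup>2 \<le> (1 + t) * (norm x)\<^sup>2 + (1 + 1 / t) * (norm y)\<^sup>2"
proof -
  have "(norm (x + y))\<^sup>2 \<le> (norm x + norm y)\<^sup>2"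
    by (intro power_mono norm_triangle_ineq norm_ge_zero)
  \<comment> \<open>The gap is a perfect square: this is 2 a b \<le> t a^2 + b^2 / t for the two
    norms a and b.\<close>
  also have "\<dots> = (1 + t) * (norm x)\<^sup>2 + (1 + 1 / t) * (norm y)\<^sup>2 - (t * norm x - norm y)\<^sup>2 / t"
    using assms by (simp add: field_simps power2_eq_square)
  also have "\<dots> \<le> (1 + t) * (norm x)\<^sup>2 + (1 + 1 / t) * (norm y)\<^sup>2"
    using assms by simp
  finally show ?thesis .
qed

text \<open>Minimising the right-hand side over \<open>t\<close> recovers the square of
  \<open>sqrt a + sqrt b\<close>; this undoes the weighting once the integrals are taken.\<close>

lemma sqrt_add_le_of_weighted:
  fixes a b c :: real
  assumes "a \<ge> 0" "b \<ge> 0"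
    and weighted: "\<And>t. t > 0 \<Longrightarrow> c \<le> (1 + t) * a + (1 + 1 / t) * b"
  shows "sqrt c \<le> sqrt a + sqrt b"
proof (rule field_le_epsilon)
  fix e :: real
  assume "e > 0"
  \<comment> \<open>The minimiser is the quotient of \<open>sqrt b\<close> by \<open>sqrt a\<close>,
    which degenerates if either vanishes. Shifting both roots by \<open>e / 2\<close> keeps them
    positive.\<close>
  define s r where "s = sqrt a + e / 2" and "r = sqrt b + e / 2"
  have pos: "s > 0" "r > 0"
    using assms(1,2) \<open>e > 0\<close> by (simp_all add: s_def r_def add_nonneg_pos)
  have "(sqrt a)\<^sup>2 \<le> s\<^sup>2" "(sqrt b)\<^sup>2 \<le> r\<^sup>2"
    using assms(1,2) \<open>e > 0\<close> unfolding s_def r_def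
    by (auto intro!: power_mono simp del: real_sqrt_pow2 real_sqrt_pow2_iff)
  then have le: "a \<le> s\<^sup>2" "b \<le> r\<^sup>2"
    using assms(1,2) by simp_all
  \<comment> \<open>With \<open>t = r / s\<close> the weights applied to the squares of
    \<open>s\<close> and \<open>r\<close> collapse to the square of \<open>s + r\<close>.\<close>
  have "c \<le> (1 + r / s) * a + (1 + 1 / (r / s)) * b"
    using pos by (intro weighted) simp
  also have "\<dots> \<le> (1 + r / s) * s\<^sup>2 + (1 + 1 / (r / s)) * r\<^sup>2"
    using pos le by (intro add_mono mult_left_mono) simp_all
  also have "\<dots> = (s + r)\<^sup>2"
    using pos by (simp add: field_simps power2_eq_square)
  finally have "sqrt c \<le> s + r"
    using pos by (intro real_le_lsqrt) simp_all
  then show "sqrt c \<le> sqrt a + sqrt b + e"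
    by (simp add: s_def r_def)
qed

lemma sum_nn_integral_weighted:
  fixes f g :: "'i \<Rightarrow> 'a \<Rightarrow> 'b :: real_normed_vector"
  assumes [measurable]: "\<And>i. i \<in> I \<Longrightarrow> f i \<in> borel_measurable M"
      "\<And>i. i \<in> I \<Longrightarrow> g i \<in> borel_measurable M"
    and "t > 0"
  shows "(\<Sum>i\<in>I. \<integral>\<^sup>+ q. ennreal ((norm (f i q + g i q))\<^sup>2) \<partial>M)
    \<le> ennreal (1 + t) * (\<Sum>i\<in>I. \<integral>\<^sup>+ q. ennreal ((norm (f i q))\<^sup>2) \<partial>M)
      + ennreal (1 + 1 / t) * (\<Sum>i\<in>I. \<integral>\<^sup>+ q. ennreal ((norm (g i q))\<^sup>2) \<partial>M)"
proof -
  have "(\<integral>\<^sup>+ q. ennreal ((norm (f i q + g i q))\<^sup>2) \<partial>M)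
    \<le> ennreal (1 + t) * (\<integral>\<^sup>+ q. ennreal ((norm (f i q))\<^sup>2) \<partial>M)
      + ennreal (1 + 1 / t) * (\<integral>\<^sup>+ q. ennreal ((norm (g i q))\<^sup>2) \<partial>M)" if "i \<in> I" for i
  proof -
    note [measurable] = assms(1,2) [OF that]
    have "(\<integral>\<^sup>+ q. ennreal ((norm (f i q + g i q))\<^sup>2) \<partial>M)
      \<le> (\<integral>\<^sup>+ q. ennreal (1 + t) * ennreal ((norm (f i q))\<^sup>2)
          + ennreal (1 + 1 / t) * ennreal ((norm (g i q))\<^sup>2) \<partial>M)"
      using \<open>t > 0\<close> norm_add_square_le
      by (intro nn_integral_mono)
        (simp add: ennreal_mult [symmetric] ennreal_plus [symmetric] ennreal_leI
          del: ennreal_plus)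
    also have "\<dots> = ennreal (1 + t) * (\<integral>\<^sup>+ q. ennreal ((norm (f i q))\<^sup>2) \<partial>M)
      + ennreal (1 + 1 / t) * (\<integral>\<^sup>+ q. ennreal ((norm (g i q))\<^sup>2) \<partial>M)"
      by (subst nn_integral_add) (simp_all add: nn_integral_cmult)
    finally show ?thesis .
  qed
  then have "(\<Sum>i\<in>I. \<integral>\<^sup>+ q. ennreal ((norm (f i q + g i q))\<^sup>2) \<partial>M)
    \<le> (\<Sum>i\<in>I. ennreal (1 + t) * (\<integral>\<^sup>+ q. ennreal ((norm (f i q))\<^sup>2) \<partial>M)
      + ennreal (1 + 1 / t) * (\<integral>\<^sup>+ q. ennreal ((norm (g i q))\<^sup>2) \<partial>M))"
    by (rule sum_mono)
  then show ?thesis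
    by (simp add: sum.distrib sum_distrib_left)
qed

text \<open>The weighted estimate holds for every \<open>t\<close>, so the sum over \<open>i\<close>
  and the integral act as a single L^2 norm. The numbers \<open>a\<close> and \<open>b\<close> are
  only upper bounds, which lets operator estimates be inserted directly.\<close>

lemma sum_nn_integral_Minkowski:
  fixes f g :: "'i \<Rightarrow> 'a \<Rightarrow> 'b :: real_normed_vector"
  assumes "\<And>i. i \<in> I \<Longrightarrow> f i \<in> borel_measurable M"
      "\<And>i. i \<in> I \<Longrightarrow> g i \<in> borel_measurable M"
    and a: "(\<Sum>i\<in>I. \<integral>\<^sup>+ q. ennreal ((norm (f i q))\<^sup>2) \<partial>M) \<le> ennreal a" "a \<ge> 0"
    and b: "(\<Sum>i\<in>I. \<integral>\<^sup>+ q. ennreal ((norm (g i q))\<^sup>2) \<partial>M) \<le> ennreal b" "b \<ge> 0"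
  shows "(\<Sum>i\<in>I. \<integral>\<^sup>+ q. ennreal ((norm (f i q + g i q))\<^sup>2) \<partial>M)
    \<le> ennreal ((sqrt a + sqrt b)\<^sup>2)"
proof -
  let ?S = "\<Sum>i\<in>I. \<integral>\<^sup>+ q. ennreal ((norm (f i q + g i q))\<^sup>2) \<partial>M"
  have S: "?S \<le> ennreal ((1 + t) * a + (1 + 1 / t) * b)" if "t > 0" for t
  proof -
    have "?S \<le> ennreal (1 + t) * ennreal a + ennreal (1 + 1 / t) * ennreal b"
      by (rule order_trans [OF sum_nn_integral_weighted [OF assms(1,2) that]])
        (auto intro!: add_mono mult_left_mono a b)
    then show ?thesis
      using that a(2) b(2)
      by (simp add: ennreal_mult [symmetric] ennreal_plus [symmetric] del: ennreal_plus)
  qed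
  \<comment> \<open>Any fixed weight shows finiteness; afterwards the argument runs over the
    reals.\<close>
  have "?S < top"
    using S [of 1] by (rule le_less_trans) simp_all
  then obtain c where c: "c \<ge> 0" "?S = ennreal c"
    by (cases ?S) (auto simp: less_top)
  have "sqrt c \<le> sqrt a + sqrt b"
  proof (rule sqrt_add_le_of_weighted [OF a(2) b(2)])
    fix t :: real
    assume "t > 0"
    then show "c \<le> (1 + t) * a + (1 + 1 / t) * b"
      using S [of t] a(2) b(2) by (simp add: c(2) ennreal_le_iff ennreal_plus [symmetric] del: ennreal_plus)
  qed
  then have "(sqrt c)\<^sup>2 \<le> (sqrt a + sqrt b)\<^sup>2"
    using c(1) by (intro power_mono) simp_all
  then show ?thesis
    using c by (simp add: ennreal_leI)
qed

section \<open>Perturbation of frames\<close>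

text \<open>The squared L^2 norm of the coefficients of \<open>x\<close>. Values in
  \<open>ennreal\<close> let it be used before finiteness is known.\<close>

definition frame_energy ::
  "quat measure \<Rightarrow> nat \<Rightarrow> (nat \<Rightarrow> quat \<Rightarrow> 'a :: right_quaternionic_inner) \<Rightarrow> 'a \<Rightarrow> ennreal" where
  "frame_energy \<mu> n \<xi> x = (\<Sum>i=1..n. \<integral>\<^sup>+ q. ennreal ((norm (qinner (\<xi> i q) x))\<^sup>2) \<partial>\<mu>)"

text \<open>On the diagonal the integrand of the weak operator integral is a real quaternion, the
  squared modulus of the coefficient. Its integrability, part of \<open>is_frame_operator\<close>,
  identifies the Bochner integral with the nonnegative one.\<close>

lemma frame_energy_eq:
  assumes "is_frame_operator \<mu> n \<eta> A"
  shows "frame_energy \<mu> n \<eta> x = ennreal (qRe (qinner x (A x)))"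
proof -
  have ket_bra: "qinner x (ket_bra (\<eta> i q) (\<eta> i q) x) = of_real ((norm (qinner (\<eta> i q) x))\<^sup>2)" for i q
    by (simp only: ket_bra_def qinner_scaleQ_right qcnj_qinner [symmetric, of x] qcnj_mult_self)
  have qRe_of_real: "qRe (of_real r) = r" for r
    by (simp add: of_real_def)
  have int: "integrable \<mu> (\<lambda>q. of_real ((norm (qinner (\<eta> i q) x))\<^sup>2) :: quat)"
    if "i \<in> {1..n}" for i
    using assms that by (simp only: is_frame_operator_def ket_bra [symmetric])
  have int': "integrable \<mu> (\<lambda>q. (norm (qinner (\<eta> i q) x))\<^sup>2)" if "i \<in> {1..n}" for i
    using integrable_bounded_linear [OF bounded_linear_qRe int [OF that]]
    by (simp only: qRe_of_real)
  have "qRe (qinner x (A x))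
    = qRe (\<Sum>i=1..n. LINT q|\<mu>. of_real ((norm (qinner (\<eta> i q) x))\<^sup>2))"
    using assms by (simp only: is_frame_operator_def ket_bra [symmetric])
  also have "\<dots> = (\<Sum>i=1..n. qRe (LINT q|\<mu>. of_real ((norm (qinner (\<eta> i q) x))\<^sup>2)))"
    by (rule linear_sum [OF bounded_linear.linear [OF bounded_linear_qRe]])
  also have "\<dots> = (\<Sum>i=1..n. LINT q|\<mu>. (norm (qinner (\<eta> i q) x))\<^sup>2)"
    using integral_bounded_linear [OF bounded_linear_qRe int]
    by (intro sum.cong) (simp_all only: qRe_of_real)
  finally have "ennreal (qRe (qinner x (A x)))
    = (\<Sum>i=1..n. ennreal (LINT q|\<mu>. (norm (qinner (\<eta> i q) x))\<^sup>2))"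
    by (simp add: sum_ennreal)
  also have "\<dots> = frame_energy \<mu> n \<eta> x"
    unfolding frame_energy_def
    by (intro sum.cong refl nn_integral_eq_integral [symmetric] int') simp_all
  finally show ?thesis ..
qed

text \<open>Cauchy-Schwarz at each \<open>q\<close>; for the family of differences the first factor
  is \<open>\<kappa>\<close>.\<close>

lemma frame_energy_le:
  assumes "measurable_family \<mu> n \<xi>"
  shows "frame_energy \<mu> n \<xi> x
    \<le> (\<Sum>i=1..n. \<integral>\<^sup>+ q. ennreal ((norm (\<xi> i q))\<^sup>2) \<partial>\<mu>) * ennreal ((norm x)\<^sup>2)"
  unfolding frame_energy_def sum_distrib_right
proof (rule sum_mono)
  fix i
  assume "i \<in> {1..n}"
  then have [measurable]: "\<xi> i \<in> borel_measurable \<mu>"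
    using assms by (simp add: measurable_family_def)
  have "(norm (qinner (\<xi> i q) x))\<^sup>2 \<le> (norm (\<xi> i q))\<^sup>2 * (norm x)\<^sup>2" for q
    using power_mono [OF norm_qinner_le norm_ge_zero, of "\<xi> i q" x 2]
    by (simp add: power_mult_distrib)
  then have "(\<integral>\<^sup>+ q. ennreal ((norm (qinner (\<xi> i q) x))\<^sup>2) \<partial>\<mu>)
    \<le> (\<integral>\<^sup>+ q. ennreal ((norm (\<xi> i q))\<^sup>2) * ennreal ((norm x)\<^sup>2) \<partial>\<mu>)"
    by (intro nn_integral_mono) (simp add: ennreal_mult [symmetric] ennreal_leI)
  then show "(\<integral>\<^sup>+ q. ennreal ((norm (qinner (\<xi> i q) x))\<^sup>2) \<partial>\<mu>)
    \<le> (\<integral>\<^sup>+ q. ennreal ((norm (\<xi> i q))\<^sup>2) \<partial>\<mu>) * ennreal ((norm x)\<^sup>2)"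
    by (simp add: nn_integral_multc)
qed

text \<open>Minkowski for the coefficients of \<xi> = \<eta> - (\<eta> - \<xi>). Separability of the
  space enters through the measurability of the difference.\<close>

lemma frame_energy_triangle:
  fixes \<xi> \<eta> :: "nat \<Rightarrow> quat \<Rightarrow> 'v :: right_quaternionic_hilbert"
  assumes "measurable_family \<mu> n \<xi>" "measurable_family \<mu> n \<eta>"
    and "frame_energy \<mu> n \<eta> x \<le> ennreal a" "a \<ge> 0"
    and "frame_energy \<mu> n (\<lambda>i q. \<eta> i q - \<xi> i q) x \<le> ennreal b" "b \<ge> 0"
  shows "frame_energy \<mu> n \<xi> x \<le> ennreal ((sqrt a + sqrt b)\<^sup>2)"
proof -
  have "(\<Sum>i=1..n. \<integral>\<^sup>+ q. ennreal ((norm (qinner (\<eta> i q) x + - qinner (\<eta> i q - \<xi> i q) x))\<^sup>2) \<partial>\<mu>)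
    \<le> ennreal ((sqrt a + sqrt b)\<^sup>2)"
    using assms unfolding frame_energy_def measurable_family_def
    by (intro sum_nn_integral_Minkowski)
      (auto intro!: borel_measurable_qinner_left borel_measurable_uminus borel_measurable_diff)
  then show ?thesis
    by (simp add: frame_energy_def qinner_diff_left)
qed

theorem theorem3p1:
  fixes \<mu> :: "quat measure"
    and n :: nat
    and \<eta> \<zeta> :: "nat \<Rightarrow> quat \<Rightarrow> 'v :: right_quaternionic_hilbert"
    and A :: "'v \<Rightarrow> 'v"
    and \<kappa> :: ennreal
  assumes "space \<mu> = UNIV"
    and "1 \<le> n"
    and "rank_continuous_frame_op \<mu> n \<eta> A"
    and "measurable_family \<mu> n \<zeta>"
    and "\<kappa> = (\<Sum>i=1..n. \<integral>\<^sup>+ q. ennreal ((norm (\<eta> i q - \<zeta> i q))\<^sup>2) \<partial>\<mu>)"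
    and "\<kappa> < ennreal (op_lower A)"
  shows "rank_continuous_frame_bounds \<mu> n \<zeta>
    (op_lower A * (1 - sqrt (enn2real \<kappa> / op_lower A))\<^sup>2)
    (op_upper A * (1 + sqrt (enn2real \<kappa> / op_upper A))\<^sup>2)"
proof -
  define k m M where "k = enn2real \<kappa>" and "m = op_lower A" and "M = op_upper A"
  have \<eta>: "measurable_family \<mu> n \<eta>" and A: "positive_operator A" "bounded_right_linear A"
    and op: "is_frame_operator \<mu> n \<eta> A"
    and indep: "right_independent {1..n} (\<lambda>i. \<eta> i 0)"
    using assms(3) by (auto simp: rank_continuous_frame_op_def)
  have \<kappa>: "\<kappa> = ennreal k"
    unfolding k_def
    by (rule ennreal_enn2real [symmetric]) (rule less_trans [OF assms(6) ennreal_less_top])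
  have "0 \<le> k"
    by (simp add: k_def)
  with assms(6) have k: "0 \<le> k" "k < m"
    by (simp_all add: \<kappa> m_def ennreal_less_iff)
  have bounds: "m * (norm x)\<^sup>2 \<le> qRe (qinner x (A x))" "qRe (qinner x (A x)) \<le> M * (norm x)\<^sup>2" for x
    unfolding m_def M_def by (rule op_lower_le op_upper_ge A)+
  \<comment> \<open>A nonzero vector is needed to deduce \<open>m \<le> M\<close> from the two
    bounds on the form, and thereby \<open>0 < M\<close>. Independence at the point 0 provides one:
    if \<open>\<eta> 1 0\<close> vanished, the coefficients supported at index 1 would give a
    nontrivial relation.\<close>
  have "\<eta> 1 0 \<noteq> 0"
  proof
    assume "\<eta> 1 0 = 0"
    define c :: "nat \<Rightarrow> quat" where "c = (\<lambda>i. if i = 1 then 1 else 0)"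
    have "\<eta> i 0 *\<^sub>Q c i = 0" for i
      using scaleQ_of_real [of "\<eta> i 0" 0] scaleQ_of_real [of "\<eta> i 0" 1] \<open>\<eta> 1 0 = 0\<close>
      by (cases "i = 1") (simp_all add: c_def)
    then have "(\<Sum>i=1..n. \<eta> i 0 *\<^sub>Q c i) = 0"
      by simp
    then have "\<forall>i\<in>{1..n}. c i = 0"
      by (rule indep [unfolded right_independent_def, THEN spec, THEN mp])
    then have "c 1 = 0"
      by (rule bspec) (use \<open>1 \<le> n\<close> in simp)
    then show False
      by (simp add: c_def)
  qed
  moreover have "m * (norm (\<eta> 1 0))\<^sup>2 \<le> M * (norm (\<eta> 1 0))\<^sup>2"
    by (rule order_trans [OF bounds])
  ultimately have "m \<le> M"
    by simp
  with k have pos: "0 < m" "0 < M"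
    by simp_all
  have sqrt_lt: "sqrt k < sqrt m"
    using k by simp
  \<comment> \<open>In this form the frame bounds are squares of a difference and a sum of L^2 norm
    bounds, as the triangle inequality produces them.\<close>
  have lower_eq: "m * (1 - sqrt (k / m))\<^sup>2 = (sqrt m - sqrt k)\<^sup>2"
  proof -
    have "m * (1 - sqrt (k / m))\<^sup>2 = (sqrt m * (1 - sqrt (k / m)))\<^sup>2"
      using pos by (simp add: power_mult_distrib)
    also have "sqrt m * (1 - sqrt (k / m)) = sqrt m - sqrt k"
      using pos by (simp add: right_diff_distrib flip: real_sqrt_mult)
    finally show ?thesis .
  qed
  have upper_eq: "M * (1 + sqrt (k / M))\<^sup>2 = (sqrt M + sqrt k)\<^sup>2"
  proof -
    have "M * (1 + sqrt (k / M))\<^sup>2 = (sqrt M * (1 + sqrt (k / M)))\<^sup>2"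
      using pos by (simp add: power_mult_distrib)
    also have "sqrt M * (1 + sqrt (k / M)) = sqrt M + sqrt k"
      using pos by (simp add: distrib_left flip: real_sqrt_mult)
    finally show ?thesis .
  qed
  have F\<eta>: "frame_energy \<mu> n \<eta> x = ennreal (qRe (qinner x (A x)))" for x
    by (rule frame_energy_eq [OF op])
  have diff: "measurable_family \<mu> n (\<lambda>i q. \<eta> i q - \<zeta> i q)"
    using \<eta> assms(4) by (auto simp: measurable_family_def intro!: borel_measurable_diff)
  have F\<delta>: "frame_energy \<mu> n (\<lambda>i q. \<eta> i q - \<zeta> i q) x \<le> ennreal (k * (norm x)\<^sup>2)" for x
    using frame_energy_le [OF diff, of x, folded assms(5)] k(1)
    by (simp add: \<kappa> ennreal_mult)
  have F\<delta>': "frame_energy \<mu> n (\<lambda>i q. \<zeta> i q - \<eta> i q) x \<le> ennreal (k * (norm x)\<^sup>2)" for x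
    using F\<delta> [of x] by (simp add: frame_energy_def qinner_diff_left norm_minus_commute)
  have upper: "frame_energy \<mu> n \<zeta> x \<le> ennreal (M * (1 + sqrt (k / M))\<^sup>2 * (norm x)\<^sup>2)" for x
  proof -
    have "frame_energy \<mu> n \<zeta> x \<le> ennreal ((sqrt (M * (norm x)\<^sup>2) + sqrt (k * (norm x)\<^sup>2))\<^sup>2)"
      using pos k bounds F\<delta>
      by (intro frame_energy_triangle [OF assms(4) \<eta>]) (simp_all add: F\<eta> ennreal_leI)
    then show ?thesis
      by (simp only: upper_eq real_sqrt_mult real_sqrt_abs abs_norm_cancel
          distrib_right [symmetric] power_mult_distrib)
  qed
  have lower: "ennreal (m * (1 - sqrt (k / m))\<^sup>2 * (norm x)\<^sup>2) \<le> frame_energy \<mu> n \<zeta> x" for x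
  proof -
    \<comment> \<open>The upper bound comes first because it makes the energy of \<zeta> a real
      number \<open>c\<close>, which can then serve as a bound in the triangle inequality with
      \<eta> and \<zeta> exchanged.\<close>
    have "frame_energy \<mu> n \<zeta> x < top"
      using upper [of x] by (rule le_less_trans) simp
    then obtain c where c: "c \<ge> 0" "frame_energy \<mu> n \<zeta> x = ennreal c"
      by (cases "frame_energy \<mu> n \<zeta> x") (auto simp: less_top)
    have "frame_energy \<mu> n \<eta> x \<le> ennreal ((sqrt c + sqrt (k * (norm x)\<^sup>2))\<^sup>2)"
      using c k F\<delta>'
      by (intro frame_energy_triangle [OF \<eta> assms(4)]) simp_all
    then have "qRe (qinner x (A x)) \<le> (sqrt c + sqrt k * norm x)\<^sup>2"
      by (simp add: F\<eta> real_sqrt_mult ennreal_le_iff)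
    with bounds(1) have "m * (norm x)\<^sup>2 \<le> (sqrt c + sqrt k * norm x)\<^sup>2"
      by (rule order_trans)
    then have "sqrt (m * (norm x)\<^sup>2) \<le> sqrt c + sqrt k * norm x"
      using c k by (intro real_le_lsqrt) simp_all
    then have "(sqrt m - sqrt k) * norm x \<le> sqrt c"
      by (simp add: real_sqrt_mult algebra_simps)
    \<comment> \<open>Squaring preserves the inequality because \<open>k < m\<close> makes the left
      factor positive.\<close>
    then have "((sqrt m - sqrt k) * norm x)\<^sup>2 \<le> (sqrt c)\<^sup>2"
      using sqrt_lt by (intro power_mono) simp_all
    then show ?thesis
      using c by (simp add: lower_eq power_mult_distrib ennreal_leI)
  qed
  have "0 < m * (1 - sqrt (k / m))\<^sup>2"
    using sqrt_lt by (simp add: lower_eq)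
  moreover have "0 < M * (1 + sqrt (k / M))\<^sup>2"
    using pos k by (intro mult_pos_pos zero_less_power add_pos_nonneg) simp_all
  ultimately show ?thesis
    using assms(4) lower upper
    by (simp add: rank_continuous_frame_bounds_def frame_energy_def k_def m_def M_def)
qed

end
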